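(* Let $G=(V,E)$ be a locally finite graph. Let $x,y\in V$ with $x\sim y$ and $d_x\ge d_y$. Then $$\kappa_0(x,y)\le\kappa(x,y)\le\kappa_0(x,y)+\frac{2}{d_x}.$$
   Context: Graphs have no multiple edges or self loops (and are undirected). $x\sim y$ means that $x$ and $y$ are joined by an edge; $d_x$ is the degree of $x$; $d(x,y)$ is the combinatorial (shortest path) distance, with $d(x,y)=\infty$ if there is no path. For $x\in V$ with $d_x\ge 1$ and $p\in[0,1]$, $\mu_x^p$ is the probability measure on $V$ with $\mu_x^p(x)=p$, $\mu_x^p(z)=\frac{1-p}{d_x}$ for $z\sim x$, and $\mu_x^p(z)=0$ otherwise. For probability measures $\mu_1,\mu_2$ on $V$, $W_1(\mu_1,\mu_2)=\inf_{\pi}\sum_{u\in V}\sum_{v\in V}d(u,v)\pi(u,v)$, the infimum being over all $\pi:V\times V\to[0,1]$ with $\sum_{v}\pi(u,v)=\mu_1(u)$ for all $u$ and $\sum_{u}\pi(u,v)=\mu_2(v)$ for all $v$ (convention $\infty\cdot 0=0$). For an edge $x\sim y$, $\kappa_p(x,y)=1-W_1(\mu_x^p,\mu_y^p)$ (so $\kappa_0$ is the case $p=0$) and $\kappa(x,y)=\lim_{p\to1}\frac{\kappa_p(x,y)}{1-p}$. *)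

theory Defs
  imports "HOL-Analysis.Analysis"
begin

definition locally_finite_graph :: "'a set \<Rightarrow> 'a set set \<Rightarrow> bool" where
  "locally_finite_graph V E \<longleftrightarrow>
     (\<forall>e\<in>E. \<exists>u\<in>V. \<exists>v\<in>V. u \<noteq> v \<and> e = {u, v}) \<and> (\<forall>x\<in>V. finite {y. {x, y} \<in> E})"

definition adj :: "'a set set \<Rightarrow> 'a \<Rightarrow> 'a \<Rightarrow> bool" where
  "adj E x y \<longleftrightarrow> {x, y} \<in> E"

definition deg :: "'a set set \<Rightarrow> 'a \<Rightarrow> nat" where
  "deg E x = card {y. adj E x y}"

text \<open>The least length of a walk from \<open>u\<close> to \<open>v\<close>; the infimum of the empty set is \<open>\<infinity>\<close>.\<close>

definition graph_dist :: "'a set set \<Rightarrow> 'a \<Rightarrow> 'a \<Rightarrow> enat" where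
  "graph_dist E u v = (INF n\<in>{n. (adj E ^^ n) u v}. enat n)"

definition idle_measure :: "'a set set \<Rightarrow> real \<Rightarrow> 'a \<Rightarrow> 'a \<Rightarrow> real" where
  "idle_measure E p x z =
     (if z = x then p else if adj E x z then (1 - p) / real (deg E x) else 0)"

definition couplings :: "'a set \<Rightarrow> ('a \<Rightarrow> real) \<Rightarrow> ('a \<Rightarrow> real) \<Rightarrow> ('a \<Rightarrow> 'a \<Rightarrow> real) set" where
  "couplings V \<mu>\<^sub>1 \<mu>\<^sub>2 = {\<pi>.
     (\<forall>u\<in>V. \<forall>v\<in>V. \<pi> u v \<in> {0..1}) \<and>
     (\<forall>u\<in>V. ((\<lambda>v. \<pi> u v) has_sum \<mu>\<^sub>1 u) V) \<and>
     (\<forall>v\<in>V. ((\<lambda>u. \<pi> u v) has_sum \<mu>\<^sub>2 v) V)}"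

text \<open>Sums and infimum are taken in \<open>[0, \<infinity>]\<close>, where \<open>\<infinity> * 0 = 0\<close> and every family is summable.\<close>

definition transport_cost :: "'a set \<Rightarrow> 'a set set \<Rightarrow> ('a \<Rightarrow> 'a \<Rightarrow> real) \<Rightarrow> ennreal" where
  "transport_cost V E \<pi> =
     (\<Sum>\<^sub>\<infinity>u\<in>V. \<Sum>\<^sub>\<infinity>v\<in>V. ennreal_of_enat (graph_dist E u v) * ennreal (\<pi> u v))"

definition W1 :: "'a set \<Rightarrow> 'a set set \<Rightarrow> ('a \<Rightarrow> real) \<Rightarrow> ('a \<Rightarrow> real) \<Rightarrow> ennreal" where
  "W1 V E \<mu>\<^sub>1 \<mu>\<^sub>2 = (INF \<pi>\<in>couplings V \<mu>\<^sub>1 \<mu>\<^sub>2. transport_cost V E \<pi>)"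

text \<open>The conversion to the reals loses nothing when \<open>x\<close> and \<open>y\<close> are adjacent and
  \<open>p \<in> {0..1}\<close>: see \<open>W1_finite\<close> below.\<close>

definition kappa_idle :: "'a set \<Rightarrow> 'a set set \<Rightarrow> real \<Rightarrow> 'a \<Rightarrow> 'a \<Rightarrow> real" where
  "kappa_idle V E p x y = 1 - enn2real (W1 V E (idle_measure E p x) (idle_measure E p y))"

text \<open>The limit is one-sided because the idleness \<open>p\<close> ranges over \<open>{0..1}\<close>; for adjacent
  \<open>x\<close> and \<open>y\<close> it exists, see \<open>kappa_tendsto\<close> below.\<close>

definition kappa :: "'a set \<Rightarrow> 'a set set \<Rightarrow> 'a \<Rightarrow> 'a \<Rightarrow> real" where
  "kappa V E x y = Lim (at_left 1) (\<lambda>p. kappa_idle V E p x y / (1 - p))"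


section \<open>Well-definedness\<close>

lemma adj_sym: "adj E x y \<Longrightarrow> adj E y x"
  by (simp add: adj_def insert_commute)

context
  fixes V :: "'a set" and E :: "'a set set"
  assumes graph: "locally_finite_graph V E"
begin

lemma adj_in: "adj E x y \<Longrightarrow> x \<in> V \<and> y \<in> V \<and> x \<noteq> y"
  using graph unfolding locally_finite_graph_def adj_def by (metis doubleton_eq_iff)

lemma finite_nbrs: "x \<in> V \<Longrightarrow> finite {y. adj E x y}"
  using graph unfolding locally_finite_graph_def adj_def by simp

lemma idle_measure_sum:
  assumes "adj E x y" "finite S" "x \<in> S" "{z. adj E x z} \<subseteq> S"
  shows "sum (idle_measure E p x) S = 1"
proof -
  have fin: "finite {z. adj E x z}" using assms adj_in finite_nbrs by blast
  have d: "deg E x > 0" unfolding deg_def using assms(1) fin card_gt_0_iff by blast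
  have nx: "x \<notin> {z. adj E x z}" using adj_in by blast
  have "sum (idle_measure E p x) S = sum (idle_measure E p x) (insert x {z. adj E x z})"
    by (rule sum.mono_neutral_right) (use assms in \<open>auto simp: idle_measure_def\<close>)
  also have "\<dots> = p + (\<Sum>z\<in>{z. adj E x z}. idle_measure E p x z)"
    using fin nx by (simp add: idle_measure_def)
  also have "(\<Sum>z\<in>{z. adj E x z}. idle_measure E p x z)
      = (\<Sum>z\<in>{z. adj E x z}. (1 - p) / real (deg E x))"
    by (rule sum.cong) (use nx in \<open>auto simp: idle_measure_def\<close>)
  also have "p + \<dots> = 1" using d by (simp add: deg_def)
  finally show ?thesis .
qed

lemma idle_measure_nonneg: "p \<in> {0..1} \<Longrightarrow> 0 \<le> idle_measure E p x z"
  by (auto simp: idle_measure_def)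

lemma idle_measure_prob:
  assumes "adj E x y"
  shows "(idle_measure E p x has_sum 1) V"
proof -
  let ?S = "insert x {z. adj E x z}"
  have fin: "finite ?S" using assms adj_in finite_nbrs by blast
  show ?thesis
    by (rule has_sum_finite_neutralI[where B = ?S])
      (use idle_measure_sum[OF assms fin, of p] fin adj_in assms in
        \<open>auto simp: idle_measure_def\<close>)
qed

lemma graph_dist_le: "(adj E ^^ n) u v \<Longrightarrow> graph_dist E u v \<le> enat n"
  unfolding graph_dist_def by (auto intro: INF_lower)

lemma graph_dist_ge_1:
  assumes "u \<noteq> v"
  shows "1 \<le> graph_dist E u v"
  unfolding graph_dist_def
proof (rule INF_greatest)
  fix n assume "n \<in> {n. (adj E ^^ n) u v}"
  then show "1 \<le> enat n" using assms by (cases n) (auto simp: one_enat_def)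
qed

context
  fixes x y :: 'a
  assumes xy: "adj E x y"
begin

definition supp :: "'a set" where
  "supp = insert x (insert y ({z. adj E x z} \<union> {z. adj E y z}))"

definition rdist :: "'a \<Rightarrow> 'a \<Rightarrow> real" where
  "rdist u v = enn2real (ennreal_of_enat (graph_dist E u v))"

lemma supp_finite: "finite supp"
  using finite_nbrs adj_in[OF xy] by (simp add: supp_def)

lemma supp_V: "supp \<subseteq> V"
  using adj_in xy by (auto simp: supp_def)

lemma x_supp: "x \<in> supp" and y_supp: "y \<in> supp"
  by (auto simp: supp_def)

lemma outside: "z \<notin> supp \<Longrightarrow> idle_measure E p x z = 0" "z \<notin> supp \<Longrightarrow> idle_measure E p y z = 0"
  by (auto simp: supp_def idle_measure_def)

lemma sum_supp: "sum (idle_measure E p x) supp = 1" "sum (idle_measure E p y) supp = 1"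
  using idle_measure_sum[OF xy supp_finite] idle_measure_sum[OF adj_sym[OF xy] supp_finite]
  by (auto simp: supp_def)

lemma walk_to: "z \<in> supp \<Longrightarrow> \<exists>n. (adj E ^^ n) z x"
proof -
  assume "z \<in> supp"
  then consider "z = x" | "adj E z x" | "adj E z y"
    unfolding supp_def using adj_sym[of E] xy by blast
  then show ?thesis
  proof cases
    case 1 then show ?thesis by (intro exI[of _ 0]) auto
  next
    case 2 then show ?thesis by (intro exI[of _ 1]) auto
  next
    case 3
    then have "(adj E ^^ Suc 1) z x" using adj_sym[OF xy] by auto
    then show ?thesis by blast
  qed
qed

lemma walk_rev: "(adj E ^^ n) u v \<Longrightarrow> (adj E ^^ n) v u"
proof (induction n arbitrary: v)
  case (Suc n)
  then obtain w where "(adj E ^^ n) u w" "adj E w v" by auto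
  then have "(adj E ^^ n) w u" "adj E v w" using Suc.IH adj_sym[of E] by auto
  then show ?case by (rule relpowp_Suc_I2[rotated])
qed auto

lemma dist_supp:
  assumes "u \<in> supp" "v \<in> supp"
  shows "ennreal_of_enat (graph_dist E u v) = ennreal (rdist u v)"
proof -
  obtain m n where "(adj E ^^ m) u x" "(adj E ^^ n) v x" using assms walk_to by blast
  then have "(adj E ^^ (m + n)) u v" using walk_rev by (auto simp: relpowp_add)
  then have "graph_dist E u v \<le> enat (m + n)" by (rule graph_dist_le)
  then obtain k where "graph_dist E u v = enat k" by (cases "graph_dist E u v") auto
  then have "ennreal_of_enat (graph_dist E u v) < top" by (simp add: of_nat_less_top)
  then show ?thesis by (simp add: rdist_def)
qed

lemma rdist_nonneg: "0 \<le> rdist u v"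
  by (simp add: rdist_def)

lemma rdist_ge_1:
  assumes "u \<in> supp" "v \<in> supp" "u \<noteq> v"
  shows "1 \<le> rdist u v"
proof -
  have "ennreal_of_enat 1 \<le> ennreal_of_enat (graph_dist E u v)"
    using graph_dist_ge_1[OF assms(3)] by (simp only: ennreal_of_enat_le_iff)
  then have "ennreal 1 \<le> ennreal (rdist u v)" using dist_supp[OF assms(1,2)] by simp
  then show ?thesis using rdist_nonneg ennreal_le_iff by blast
qed

lemma rdist_xy: "rdist x y = 1"
proof -
  have "graph_dist E x y \<le> enat 1" by (rule graph_dist_le) (use xy in auto)
  moreover have "1 \<le> graph_dist E x y" by (rule graph_dist_ge_1) (use adj_in[OF xy] in auto)
  ultimately have "graph_dist E x y = 1" by (simp add: one_enat_def)
  then show ?thesis by (simp add: rdist_def)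
qed

abbreviation cpl :: "real \<Rightarrow> ('a \<Rightarrow> 'a \<Rightarrow> real) set" where
  "cpl p \<equiv> couplings V (idle_measure E p x) (idle_measure E p y)"

abbreviation rcost :: "('a \<Rightarrow> 'a \<Rightarrow> real) \<Rightarrow> real" where
  "rcost \<pi> \<equiv> (\<Sum>u\<in>supp. \<Sum>v\<in>supp. rdist u v * \<pi> u v)"

lemma cpl_zero:
  assumes "\<pi> \<in> cpl p" "u \<in> V" "v \<in> V" "u \<notin> supp \<or> v \<notin> supp"
  shows "\<pi> u v = 0"
proof -
  have nn: "\<pi> a b \<ge> 0" if "a \<in> V" "b \<in> V" for a b
    using assms(1) that by (auto simp: couplings_def)
  have r: "((\<lambda>b. \<pi> u b) has_sum idle_measure E p x u) V"
    and c: "((\<lambda>a. \<pi> a v) has_sum idle_measure E p y v) V"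
    using assms by (auto simp: couplings_def)
  from assms(4) show ?thesis
  proof
    assume "u \<notin> supp"
    then show ?thesis
      using nonneg_has_sum_le_0D[OF r, of v] outside(1)[of u p] nn assms by auto
  next
    assume "v \<notin> supp"
    then show ?thesis
      using nonneg_has_sum_le_0D[OF c, of u] outside(2)[of v p] nn assms by auto
  qed
qed

lemma cost_eq:
  assumes "\<pi> \<in> cpl p"
  shows "transport_cost V E \<pi> = ennreal (rcost \<pi>)" "0 \<le> rcost \<pi>"
proof -
  have nn: "\<pi> a b \<ge> 0" if "a \<in> supp" "b \<in> supp" for a b
    using assms that subsetD[OF supp_V] by (auto simp: couplings_def)
  have "(\<Sum>\<^sub>\<infinity>v\<in>V. ennreal_of_enat (graph_dist E u v) * ennreal (\<pi> u v)) =
      (\<Sum>v\<in>supp. ennreal_of_enat (graph_dist E u v) * ennreal (\<pi> u v))" if "u \<in> V" for u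
  proof -
    have "(\<Sum>\<^sub>\<infinity>v\<in>V. ennreal_of_enat (graph_dist E u v) * ennreal (\<pi> u v)) =
      (\<Sum>\<^sub>\<infinity>v\<in>supp. ennreal_of_enat (graph_dist E u v) * ennreal (\<pi> u v))"
      by (rule infsum_cong_neutral) (use supp_V cpl_zero[OF assms that] in auto)
    then show ?thesis using supp_finite by simp
  qed
  then have "transport_cost V E \<pi> =
      (\<Sum>\<^sub>\<infinity>u\<in>V. \<Sum>v\<in>supp. ennreal_of_enat (graph_dist E u v) * ennreal (\<pi> u v))"
    unfolding transport_cost_def by (rule infsum_cong)
  also have "\<dots> = (\<Sum>\<^sub>\<infinity>u\<in>supp. \<Sum>v\<in>supp. ennreal_of_enat (graph_dist E u v) * ennreal (\<pi> u v))"
    by (rule infsum_cong_neutral)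
      (use supp_V cpl_zero[OF assms] in \<open>auto intro!: sum.neutral\<close>)
  also have "\<dots> = (\<Sum>u\<in>supp. \<Sum>v\<in>supp. ennreal_of_enat (graph_dist E u v) * ennreal (\<pi> u v))"
    using supp_finite by simp
  also have "\<dots> = (\<Sum>u\<in>supp. \<Sum>v\<in>supp. ennreal (rdist u v * \<pi> u v))"
    by (intro sum.cong refl) (use nn dist_supp rdist_nonneg in \<open>simp add: ennreal_mult\<close>)
  also have "\<dots> = ennreal (rcost \<pi>)"
    using nn rdist_nonneg by (simp add: sum_nonneg)
  finally show "transport_cost V E \<pi> = ennreal (rcost \<pi>)" .
  show "0 \<le> rcost \<pi>" using nn rdist_nonneg by (intro sum_nonneg mult_nonneg_nonneg) auto
qed

lemma cplI:
  assumes "\<And>u v. u \<in> supp \<Longrightarrow> v \<in> supp \<Longrightarrow> 0 \<le> \<pi> u v"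
    and zero: "\<And>u v. u \<notin> supp \<or> v \<notin> supp \<Longrightarrow> \<pi> u v = 0"
    and row: "\<And>u. u \<in> supp \<Longrightarrow> (\<Sum>v\<in>supp. \<pi> u v) = idle_measure E p x u"
    and col: "\<And>v. v \<in> supp \<Longrightarrow> (\<Sum>u\<in>supp. \<pi> u v) = idle_measure E p y v"
    and p: "p \<in> {0..1}"
  shows "\<pi> \<in> cpl p"
proof -
  have nn: "0 \<le> \<pi> u v" for u v using assms(1) zero by (cases "u \<in> supp \<and> v \<in> supp") auto
  have row': "(\<Sum>v\<in>supp. \<pi> u v) = idle_measure E p x u" for u
    using row zero outside by (cases "u \<in> supp") auto
  have col': "(\<Sum>u\<in>supp. \<pi> u v) = idle_measure E p y v" for v
    using col zero outside by (cases "v \<in> supp") auto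
  have "\<pi> u v \<le> 1" for u v
  proof (cases "u \<in> supp \<and> v \<in> supp")
    case True
    have "\<pi> u v \<le> (\<Sum>v\<in>supp. \<pi> u v)"
      using nn True supp_finite by (intro member_le_sum) auto
    also have "\<dots> \<le> sum (idle_measure E p x) supp" unfolding row'
      using True supp_finite idle_measure_nonneg[OF p] by (intro member_le_sum) auto
    finally show ?thesis by (simp add: sum_supp)
  qed (use zero in auto)
  moreover have "((\<lambda>v. \<pi> u v) has_sum idle_measure E p x u) V" for u
    by (rule has_sum_finite_neutralI[OF supp_finite supp_V]) (use zero row' in auto)
  moreover have "((\<lambda>u. \<pi> u v) has_sum idle_measure E p y v) V" for v
    by (rule has_sum_finite_neutralI[OF supp_finite supp_V]) (use zero col' in auto)
  ultimately show ?thesis using nn by (auto simp: couplings_def)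
qed

lemma cpl_sums:
  assumes "\<pi> \<in> cpl p"
  shows "u \<in> supp \<Longrightarrow> (\<Sum>v\<in>supp. \<pi> u v) = idle_measure E p x u"
    and "v \<in> supp \<Longrightarrow> (\<Sum>u\<in>supp. \<pi> u v) = idle_measure E p y v"
proof -
  assume u: "u \<in> supp"
  have "((\<lambda>v. \<pi> u v) has_sum (\<Sum>v\<in>supp. \<pi> u v)) V"
    by (rule has_sum_finite_neutralI[OF supp_finite supp_V])
      (use cpl_zero[OF assms] u supp_V in auto)
  moreover have "((\<lambda>v. \<pi> u v) has_sum idle_measure E p x u) V"
    using assms u supp_V by (auto simp: couplings_def)
  ultimately show "(\<Sum>v\<in>supp. \<pi> u v) = idle_measure E p x u" by (rule has_sum_unique)
next
  assume v: "v \<in> supp"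
  have "((\<lambda>u. \<pi> u v) has_sum (\<Sum>u\<in>supp. \<pi> u v)) V"
    by (rule has_sum_finite_neutralI[OF supp_finite supp_V])
      (use cpl_zero[OF assms] v supp_V in auto)
  moreover have "((\<lambda>u. \<pi> u v) has_sum idle_measure E p y v) V"
    using assms v supp_V by (auto simp: couplings_def)
  ultimately show "(\<Sum>u\<in>supp. \<pi> u v) = idle_measure E p y v" by (rule has_sum_unique)
qed

lemma cpl_nonempty:
  assumes "p \<in> {0..1}"
  shows "(\<lambda>u v. idle_measure E p x u * idle_measure E p y v) \<in> cpl p"
  by (rule cplI)
    (use assms outside sum_supp idle_measure_nonneg[OF assms] in
      \<open>auto simp: sum_distrib_left[symmetric] sum_distrib_right[symmetric]\<close>)

lemma W1_finite:
  assumes "p \<in> {0..1}"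
  shows "W1 V E (idle_measure E p x) (idle_measure E p y) < \<infinity>"
proof -
  have "W1 V E (idle_measure E p x) (idle_measure E p y)
      \<le> transport_cost V E (\<lambda>u v. idle_measure E p x u * idle_measure E p y v)"
    unfolding W1_def by (rule INF_lower[OF cpl_nonempty[OF assms]])
  also have "\<dots> < \<infinity>" using cost_eq(1)[OF cpl_nonempty[OF assms]] by simp
  finally show ?thesis .
qed

abbreviation rW :: "real \<Rightarrow> real" where
  "rW p \<equiv> enn2real (W1 V E (idle_measure E p x) (idle_measure E p y))"

lemma rW_le:
  assumes "\<pi> \<in> cpl p"
  shows "rW p \<le> rcost \<pi>"
proof -
  have "W1 V E (idle_measure E p x) (idle_measure E p y) \<le> ennreal (rcost \<pi>)"
    unfolding W1_def cost_eq(1)[OF assms, symmetric] by (rule INF_lower[OF assms])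
  then show ?thesis using cost_eq(2)[OF assms] by (rule enn2real_leI[rotated])
qed

lemma rW_approx:
  assumes "p \<in> {0..1}" "0 < e"
  obtains \<pi> where "\<pi> \<in> cpl p" "rcost \<pi> < rW p + e"
proof -
  have "W1 V E (idle_measure E p x) (idle_measure E p y) = ennreal (rW p)"
    using W1_finite[OF assms(1)] by simp
  also have "\<dots> < ennreal (rW p + e)" using assms(2) by (simp add: ennreal_less_iff)
  finally obtain \<pi> where \<pi>: "\<pi> \<in> cpl p" "transport_cost V E \<pi> < ennreal (rW p + e)"
    unfolding W1_def by (auto simp: INF_less_iff)
  then have "rcost \<pi> < rW p + e" using cost_eq[OF \<pi>(1)] by (simp add: ennreal_less_iff)
  then show ?thesis using that \<pi>(1) by blast
qed

lemma rW_convex: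
  assumes p: "0 \<le> p" "p < q" "q < 1"
  defines "t \<equiv> (1 - q) / (1 - p)"
  shows "rW q \<le> t * rW p + (1 - t)"
proof -
  have t: "0 < t" "t < 1" "t * (1 - p) = 1 - q" using p by (auto simp: t_def field_simps)
  define \<delta> :: "'a \<Rightarrow> 'a \<Rightarrow> real" where "\<delta> u v = (if u = x \<and> v = y then 1 else 0)" for u v
  have mix: "idle_measure E q w z = t * idle_measure E p w z + (1 - t) * (if z = w then 1 else 0)"
    for w z using t(3) by (auto simp: idle_measure_def field_simps)
  have rs: "(\<Sum>v\<in>supp. \<delta> u v) = (if u = x then 1 else 0)" for u
    using supp_finite y_supp by (cases "u = x") (auto simp: \<delta>_def sum.delta)
  have cs: "(\<Sum>u\<in>supp. \<delta> u v) = (if v = y then 1 else 0)" for v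
    using supp_finite x_supp by (cases "v = y") (auto simp: \<delta>_def sum.delta)
  have cd: "rcost \<delta> = 1"
  proof -
    have "rcost \<delta> = (\<Sum>u\<in>supp. \<Sum>v\<in>supp. rdist x y * \<delta> u v)"
      by (intro sum.cong refl) (auto simp: \<delta>_def)
    then show ?thesis using supp_finite x_supp by (simp add: rs rdist_xy)
  qed
  have key: "rW q \<le> t * (rW p + e) + (1 - t)" if e: "e > 0" for e
  proof -
    obtain \<pi> where \<pi>: "\<pi> \<in> cpl p" "rcost \<pi> < rW p + e"
      by (rule rW_approx[of p e]) (use p e in auto)
    define \<rho> where "\<rho> u v = (if u \<in> supp \<and> v \<in> supp then t * \<pi> u v + (1 - t) * \<delta> u v else 0)" for u v
    have \<rho>: "\<rho> \<in> cpl q"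
    proof (rule cplI)
      fix u v assume "u \<in> supp" "v \<in> supp"
      then have "0 \<le> \<pi> u v" using \<pi>(1) subsetD[OF supp_V] by (auto simp: couplings_def)
      then show "0 \<le> \<rho> u v" using t by (auto simp: \<rho>_def \<delta>_def)
    next
      fix u assume u: "u \<in> supp"
      then have "(\<Sum>v\<in>supp. \<rho> u v) = (\<Sum>v\<in>supp. t * \<pi> u v + (1 - t) * \<delta> u v)"
        by (intro sum.cong) (auto simp: \<rho>_def)
      also have "\<dots> = t * (\<Sum>v\<in>supp. \<pi> u v) + (1 - t) * (\<Sum>v\<in>supp. \<delta> u v)"
        by (simp add: sum.distrib sum_distrib_left)
      finally show "(\<Sum>v\<in>supp. \<rho> u v) = idle_measure E q x u"
        using cpl_sums(1)[OF \<pi>(1) u] by (simp add: rs mix)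
    next
      fix v assume v: "v \<in> supp"
      then have "(\<Sum>u\<in>supp. \<rho> u v) = (\<Sum>u\<in>supp. t * \<pi> u v + (1 - t) * \<delta> u v)"
        by (intro sum.cong) (auto simp: \<rho>_def)
      also have "\<dots> = t * (\<Sum>u\<in>supp. \<pi> u v) + (1 - t) * (\<Sum>u\<in>supp. \<delta> u v)"
        by (simp add: sum.distrib sum_distrib_left)
      finally show "(\<Sum>u\<in>supp. \<rho> u v) = idle_measure E q y v"
        using cpl_sums(2)[OF \<pi>(1) v] by (simp add: cs mix)
    qed (use p in \<open>auto simp: \<rho>_def\<close>)
    have "rcost \<rho> = (\<Sum>u\<in>supp. \<Sum>v\<in>supp.
        t * (rdist u v * \<pi> u v) + (1 - t) * (rdist u v * \<delta> u v))"
      by (intro sum.cong refl) (auto simp: \<rho>_def algebra_simps)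
    also have "\<dots> = t * rcost \<pi> + (1 - t) * rcost \<delta>"
      by (simp add: sum.distrib sum_distrib_left)
    also have "\<dots> \<le> t * (rW p + e) + (1 - t)"
      using \<pi>(2) t cd by simp
    finally show ?thesis using rW_le[OF \<rho>] by linarith
  qed
  have "rW q \<le> t * rW p + (1 - t) + d" if "d > 0" for d
    using key[of "d / t"] that t(1) by (simp add: distrib_left)
  then show ?thesis by (rule field_le_epsilon)
qed

lemma rW_ge:
  assumes "0 \<le> p" "p < 1"
  shows "2 * p - 1 \<le> rW p"
proof (rule field_le_epsilon)
  fix e :: real assume "0 < e"
  then obtain \<pi> where \<pi>: "\<pi> \<in> cpl p" "rcost \<pi> < rW p + e"
    using rW_approx[of p e] assms by auto
  have nn: "\<pi> a b \<ge> 0" if "a \<in> supp" "b \<in> supp" for a b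
    using \<pi>(1) that subsetD[OF supp_V] by (auto simp: couplings_def)
  have "\<pi> x x \<le> (\<Sum>u\<in>supp. \<pi> u x)"
    using nn x_supp supp_finite by (intro member_le_sum) auto
  also have "\<dots> = idle_measure E p y x" using cpl_sums(2)[OF \<pi>(1) x_supp] .
  also have "\<dots> \<le> 1 - p"
  proof -
    have "deg E y \<ge> 1" unfolding deg_def
      using finite_nbrs adj_in[OF xy] adj_sym[OF xy] by (auto simp: Suc_le_eq card_gt_0_iff)
    then show ?thesis using adj_in[OF xy] assms
      by (auto simp: idle_measure_def divide_le_eq mult_le_cancel_left1)
  qed
  finally have xx: "\<pi> x x \<le> 1 - p" .
  have "p = \<pi> x x + (\<Sum>v\<in>supp - {x}. \<pi> x v)"
    using cpl_sums(1)[OF \<pi>(1) x_supp] sum.remove[OF supp_finite x_supp, of "\<pi> x"]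
    by (simp add: idle_measure_def)
  then have "2 * p - 1 \<le> (\<Sum>v\<in>supp - {x}. \<pi> x v)" using xx by linarith
  also have "\<dots> \<le> (\<Sum>v\<in>supp - {x}. rdist x v * \<pi> x v)"
    using rdist_ge_1[OF x_supp] nn[OF x_supp] by (intro sum_mono) (force simp: mult_le_cancel_right1)
  also have "\<dots> \<le> (\<Sum>v\<in>supp. rdist x v * \<pi> x v)"
    using supp_finite rdist_nonneg nn[OF x_supp] by (intro sum_mono2) auto
  also have "\<dots> \<le> rcost \<pi>"
    using supp_finite rdist_nonneg nn x_supp
    by (intro member_le_sum[where f = "\<lambda>u. \<Sum>v\<in>supp. rdist u v * \<pi> u v"] sum_nonneg) auto
  finally show "2 * p - 1 \<le> rW p + e" using \<pi>(2) by linarith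
qed

lemma kappa_tendsto: "((\<lambda>p. kappa_idle V E p x y / (1 - p)) \<longlongrightarrow> kappa V E x y) (at_left 1)"
proof -
  define h where "h p = kappa_idle V E p x y / (1 - p)" for p
  have mono: "h p \<le> h q" if "0 \<le> p" "p < q" "q < 1" for p q
  proof -
    define t where "t = (1 - q) / (1 - p)"
    have "rW q \<le> t * rW p + (1 - t)" unfolding t_def by (rule rW_convex[OF that])
    then have "t * (1 - rW p) \<le> 1 - rW q" by (simp add: algebra_simps)
    then show ?thesis using that by (simp add: h_def kappa_idle_def t_def field_simps)
  qed
  have bdd: "h p \<le> 2" if "0 \<le> p" "p < 1" for p
    using rW_ge[OF that] that by (simp add: h_def kappa_idle_def field_simps)
  have bd: "bdd_above (h ` {0..<1})" by (rule bdd_aboveI[of _ 2]) (use bdd in auto)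
  have "(h \<longlongrightarrow> (SUP p\<in>{0..<1}. h p)) (at_left 1)"
  proof (rule increasing_tendsto)
    have "\<forall>\<^sub>F p in at_left 1. p \<in> {0<..<1::real}" by (rule eventually_at_leftI[of 0]) auto
    then show "\<forall>\<^sub>F p in at_left 1. h p \<le> (SUP p\<in>{0..<1}. h p)"
      by eventually_elim (auto intro!: cSUP_upper[OF _ bd])
  next
    fix c assume "c < (SUP p\<in>{0..<1}. h p)"
    then obtain p where p: "p \<in> {0..<1}" "c < h p"
      using less_cSUP_iff[OF _ bd, of c] by auto
    have "\<forall>\<^sub>F q in at_left 1. q \<in> {p<..<1}" by (rule eventually_at_leftI[of p]) (use p in auto)
    then show "\<forall>\<^sub>F q in at_left 1. c < h q"
      by eventually_elim (use p mono[of p] in \<open>force\<close>)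
  qed
  moreover from this have "kappa V E x y = (SUP p\<in>{0..<1}. h p)"
    unfolding kappa_def h_def by (intro tendsto_Lim) auto
  ultimately show ?thesis by (simp add: h_def[abs_def])
qed

end

end

end

theory Submission
  imports Defs
begin

text \<open>The lower bound is convexity of \<open>W1\<close> in the idleness. For the upper bound, take a coupling
  \<open>\<pi>\<close> at idleness \<open>p\<close>. A common neighbour \<open>z\<close> of \<open>x\<close> and \<open>y\<close> has supply
  \<open>(1 - p) / d\<^sub>x\<close> and at least as much demand \<open>(1 - p) / d\<^sub>y\<close>, so \<open>\<pi>\<close> may be rerouted to
  leave all mass at \<open>z\<close> in place. Now concatenate the mass moved by \<open>z \<rightarrow> y\<close> (\<open>z \<noteq> x\<close>) with
  the mass moved by \<open>x \<rightarrow> w\<close> (\<open>w \<noteq> y\<close>), which are equal in amount, into \<open>z \<rightarrow> w\<close>, and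
  drop \<open>x \<rightarrow> y\<close>. Since \<open>z\<close> is a neighbour of \<open>x\<close>, the new cost of \<open>z \<rightarrow> w\<close> is at most
  \<open>1 + d(x,w)\<close>; as the remaining \<open>z \<noteq> y\<close> have
  \<open>d(z,y) = 2\<close>, this saves \<open>p\<close> up to twice the mass
  staying at \<open>y\<close>, that is, up to \<open>2 (1 - p) / d\<^sub>x\<close>. Dividing by \<open>1 - p\<close> gives a coupling at
  idleness \<open>0\<close>.\<close>

section \<open>Transport plans on a finite set\<close>

text \<open>Finite-sum form of a coupling, used on \<open>supp E x y\<close>, where all mass lies.
  The total mass is free, so that plans of mass \<open>1 - p\<close> also fit.\<close>

definition plan :: "'a set \<Rightarrow> ('a \<Rightarrow> 'a \<Rightarrow> real) \<Rightarrow> ('a \<Rightarrow> real) \<Rightarrow> ('a \<Rightarrow> real) \<Rightarrow> bool" where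
  "plan S \<pi> f g \<longleftrightarrow> (\<forall>u\<in>S. \<forall>v\<in>S. 0 \<le> \<pi> u v) \<and>
     (\<forall>u\<in>S. (\<Sum>v\<in>S. \<pi> u v) = f u) \<and> (\<forall>v\<in>S. (\<Sum>u\<in>S. \<pi> u v) = g v)"

definition cost :: "'a set \<Rightarrow> ('a \<Rightarrow> 'a \<Rightarrow> real) \<Rightarrow> ('a \<Rightarrow> 'a \<Rightarrow> real) \<Rightarrow> real" where
  "cost S d \<pi> = (\<Sum>u\<in>S. \<Sum>v\<in>S. d u v * \<pi> u v)"

text \<open>One-sided: mass from other points may still arrive at \<open>u\<close>.\<close>

definition stays :: "'a set \<Rightarrow> ('a \<Rightarrow> 'a \<Rightarrow> real) \<Rightarrow> 'a \<Rightarrow> bool" where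
  "stays S \<pi> u \<longleftrightarrow> (\<forall>v\<in>S - {u}. \<pi> u v = 0)"

text \<open>Isolates the source \<open>x\<close> and the target \<open>y\<close> whose mass a
  surgery concatenates. The case \<open>x = y\<close> is allowed and serves for rerouting through a
  single point.\<close>

lemma cost_split:
  assumes "finite S" "x \<in> S" "y \<in> S"
  shows "cost S d \<pi> = d x y * \<pi> x y + (\<Sum>w\<in>S - {y}. d x w * \<pi> x w) +
    (\<Sum>z\<in>S - {x}. d z y * \<pi> z y) + (\<Sum>z\<in>S - {x}. \<Sum>w\<in>S - {y}. d z w * \<pi> z w)"
proof -
  have r: "(\<Sum>w\<in>S. d u w * \<pi> u w) = d u y * \<pi> u y + (\<Sum>w\<in>S - {y}. d u w * \<pi> u w)" for u
    using assms by (intro sum.remove) auto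
  have "cost S d \<pi> = (\<Sum>w\<in>S. d x w * \<pi> x w) + (\<Sum>z\<in>S - {x}. \<Sum>w\<in>S. d z w * \<pi> z w)"
    unfolding cost_def using assms by (intro sum.remove) auto
  then show ?thesis by (simp add: r sum.distrib)
qed

text \<open>The operation behind both surgeries: the mass arriving along \<open>\<alpha>\<close> is passed on along \<open>\<beta>\<close>,
  in proportion. If \<open>b = 0\<close> there is no mass to pass on and the quotients are \<open>0\<close>.\<close>

lemma concat_cost_le:
  fixes \<alpha> \<beta> :: "'a \<Rightarrow> real"
  assumes d: "\<And>u w. u \<in> A \<Longrightarrow> w \<in> B \<Longrightarrow> \<alpha> u \<noteq> 0 \<Longrightarrow> d u w \<le> k u + l w"
    and nn: "\<And>u. u \<in> A \<Longrightarrow> 0 \<le> \<alpha> u" "\<And>w. w \<in> B \<Longrightarrow> 0 \<le> \<beta> w" "0 \<le> b"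
  shows "(\<Sum>u\<in>A. \<Sum>w\<in>B. d u w * (\<alpha> u * \<beta> w / b)) \<le>
    (\<Sum>u\<in>A. k u * \<alpha> u) * (sum \<beta> B / b) + (sum \<alpha> A / b) * (\<Sum>w\<in>B. l w * \<beta> w)"
proof -
  have "(\<Sum>u\<in>A. \<Sum>w\<in>B. d u w * (\<alpha> u * \<beta> w / b)) \<le>
      (\<Sum>u\<in>A. \<Sum>w\<in>B. (k u * \<alpha> u) * (\<beta> w / b) + (\<alpha> u / b) * (l w * \<beta> w))"
  proof (intro sum_mono)
    fix u w assume uw: "u \<in> A" "w \<in> B"
    have "d u w * (\<alpha> u * \<beta> w / b) \<le> (k u + l w) * (\<alpha> u * \<beta> w / b)"
    proof (cases "\<alpha> u = 0")
      case False
      then show ?thesis using d uw nn by (intro mult_right_mono) auto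
    qed simp
    also have "\<dots> = (k u * \<alpha> u) * (\<beta> w / b) + (\<alpha> u / b) * (l w * \<beta> w)"
      by (simp add: algebra_simps add_divide_distrib)
    finally show "d u w * (\<alpha> u * \<beta> w / b) \<le> (k u * \<alpha> u) * (\<beta> w / b) + (\<alpha> u / b) * (l w * \<beta> w)" .
  qed
  also have "\<dots> = (\<Sum>u\<in>A. k u * \<alpha> u) * (sum \<beta> B / b) + (sum \<alpha> A / b) * (\<Sum>w\<in>B. l w * \<beta> w)"
    by (simp only: sum.distrib sum_distrib_left[symmetric] sum_distrib_right[symmetric]
        sum_divide_distrib[symmetric])
  finally show ?thesis .
qed

section \<open>Leaving mass in place\<close>

text \<open>As \<open>f z \<le> g z\<close>, the mass \<open>a\<close> leaving \<open>z\<close> is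
  at most the mass \<open>b\<close> arriving from elsewhere. Passing a fraction \<open>a / b\<close>
  of each arrival straight on to the targets of \<open>z\<close> costs no more, by the triangle
  inequality. A point that already stays sends nothing to \<open>z\<close>, so nothing of it is
  rerouted; this makes the step iterable.\<close>

lemma plan_stay:
  fixes \<pi> :: "'a \<Rightarrow> 'a \<Rightarrow> real"
  assumes S: "finite S" "z \<in> S" and \<pi>: "plan S \<pi> f g" and fg: "f z \<le> g z"
    and tri: "\<And>u w. u \<in> S \<Longrightarrow> w \<in> S \<Longrightarrow> d u w \<le> d u z + d z w"
    and d0: "d z z = 0"
  obtains \<rho> where "plan S \<rho> f g" "cost S d \<rho> \<le> cost S d \<pi>" "stays S \<rho> z"
    "\<And>u. u \<in> S \<Longrightarrow> stays S \<pi> u \<Longrightarrow> stays S \<rho> u"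
proof -
  define T where "T = S - {z}"
  define a where "a = (\<Sum>w\<in>T. \<pi> z w)"
  define b where "b = (\<Sum>u\<in>T. \<pi> u z)"
  have nn: "0 \<le> \<pi> u v" if "u \<in> S" "v \<in> S" for u v using \<pi> that by (auto simp: plan_def)
  have S_eq: "sum h S = h z + sum h T" for h :: "'a \<Rightarrow> real"
    unfolding T_def using S by (rule sum.remove)
  have row: "\<pi> u z + (\<Sum>v\<in>T. \<pi> u v) = f u" if "u \<in> S" for u
    using \<pi> that S_eq[of "\<pi> u"] by (simp add: plan_def)
  have col: "\<pi> z v + (\<Sum>u\<in>T. \<pi> u v) = g v" if "v \<in> S" for v
    using \<pi> that S_eq[of "\<lambda>u. \<pi> u v"] by (simp add: plan_def)
  have ab: "0 \<le> a" "a \<le> b"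
    using row[OF S(2)] col[OF S(2)] fg nn S by (auto simp: a_def b_def T_def intro!: sum_nonneg)
  \<comment> \<open>Since \<open>a \<le> b\<close>, the case \<open>b = 0\<close> has no outgoing
    mass, so the value 0 of the quotients by \<open>b\<close> loses nothing.\<close>
  have out0: "\<pi> z w = 0" if "b = 0" "w \<in> T" for w
  proof -
    have "(\<Sum>w\<in>T. \<pi> z w) = 0" using that(1) ab by (simp add: a_def)
    then show ?thesis
      by (rule sum_nonneg_0[rotated 2]) (use that(2) nn S in \<open>auto simp: T_def\<close>)
  qed
  \<comment> \<open>Row \<open>z\<close> is concentrated at \<open>z\<close>; of the mass
    \<open>\<pi> u z\<close>, the share \<open>1 - a / b\<close> still ends at \<open>z\<close> and
    the rest goes on in proportion to \<open>\<pi> z v\<close>.\<close>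
  define \<rho> where "\<rho> u v = (if u = z then (if v = z then f z else 0)
    else if v = z then \<pi> u z * (1 - a / b) else \<pi> u v + \<pi> u z * \<pi> z v / b)" for u v
  have r1: "0 \<le> 1 - a / b" using ab by (cases "b = 0") (auto simp: divide_le_eq)
  have fz: "f z = \<pi> z z + a" "g z = \<pi> z z + b"
    using row[OF S(2)] col[OF S(2)] by (auto simp: a_def b_def)
  have "plan S \<rho> f g"
    unfolding plan_def
  proof (intro conjI ballI)
    fix u v assume "u \<in> S" "v \<in> S"
    then show "0 \<le> \<rho> u v" using nn S r1 ab fz by (auto simp: \<rho>_def)
  next
    fix u assume u: "u \<in> S"
    show "(\<Sum>v\<in>S. \<rho> u v) = f u"
    proof (cases "u = z")
      case True
      then show ?thesis by (simp add: S_eq) (simp add: \<rho>_def T_def)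
    next
      case False
      have "(\<Sum>v\<in>T. \<rho> u v) = (\<Sum>v\<in>T. \<pi> u v + \<pi> u z * \<pi> z v / b)"
        using False by (intro sum.cong) (auto simp: \<rho>_def T_def)
      also have "\<dots> = (\<Sum>v\<in>T. \<pi> u v) + \<pi> u z * a / b"
        by (simp add: sum.distrib a_def sum_distrib_left sum_divide_distrib)
      finally show ?thesis using row[OF u] False by (simp add: S_eq \<rho>_def algebra_simps)
    qed
  next
    fix v assume v: "v \<in> S"
    show "(\<Sum>u\<in>S. \<rho> u v) = g v"
    proof (cases "v = z")
      case True
      have "(\<Sum>u\<in>T. \<rho> u z) = (\<Sum>u\<in>T. \<pi> u z * (1 - a / b))"
        by (intro sum.cong) (auto simp: \<rho>_def T_def)
      also have "\<dots> = b * (1 - a / b)" by (simp add: b_def sum_distrib_right)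
      also have "\<dots> = b - a" using ab by (cases "b = 0") (auto simp: field_simps)
      finally show ?thesis using True fz by (simp add: S_eq) (simp add: \<rho>_def)
    next
      case False
      have "(\<Sum>u\<in>T. \<rho> u v) = (\<Sum>u\<in>T. \<pi> u v + \<pi> u z * \<pi> z v / b)"
        using False by (intro sum.cong) (auto simp: \<rho>_def T_def)
      also have "\<dots> = (\<Sum>u\<in>T. \<pi> u v) + b * \<pi> z v / b"
        by (simp add: sum.distrib b_def sum_distrib_right sum_divide_distrib)
      also have "b * \<pi> z v / b = \<pi> z v" using out0[of v] v False by (auto simp: T_def)
      finally show ?thesis using col[OF v] False by (simp add: S_eq) (simp add: \<rho>_def)
    qed
  qed
  moreover have "cost S d \<rho> \<le> cost S d \<pi>"
  proof -
    define I where "I = (\<Sum>u\<in>T. d u z * \<pi> u z)"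
    define J where "J = (\<Sum>w\<in>T. d z w * \<pi> z w)"
    define K where "K = (\<Sum>u\<in>T. \<Sum>w\<in>T. d u w * \<pi> u w)"
    have "(\<Sum>u\<in>T. \<Sum>w\<in>T. d u w * \<rho> u w) =
        (\<Sum>u\<in>T. \<Sum>w\<in>T. d u w * \<pi> u w + d u w * (\<pi> u z * \<pi> z w / b))"
      by (intro sum.cong refl) (auto simp: \<rho>_def T_def algebra_simps)
    also have "\<dots> = K + (\<Sum>u\<in>T. \<Sum>w\<in>T. d u w * (\<pi> u z * \<pi> z w / b))"
      by (simp add: sum.distrib K_def)
    also have "(\<Sum>u\<in>T. \<Sum>w\<in>T. d u w * (\<pi> u z * \<pi> z w / b)) \<le>
        I * ((\<Sum>w\<in>T. \<pi> z w) / b) + ((\<Sum>u\<in>T. \<pi> u z) / b) * J"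
      unfolding I_def J_def by (rule concat_cost_le) (use tri nn S ab in \<open>auto simp: T_def\<close>)
    also have "\<dots> = I * (a / b) + (b / b) * J" by (simp only: a_def b_def)
    also have "(b / b) * J = J" using out0 by (auto simp: J_def)
    finally have 1: "(\<Sum>u\<in>T. \<Sum>w\<in>T. d u w * \<rho> u w) \<le> K + I * (a / b) + J" by simp
    have "(\<Sum>u\<in>T. d u z * \<rho> u z) = (\<Sum>u\<in>T. d u z * \<pi> u z * (1 - a / b))"
      by (intro sum.cong) (auto simp: \<rho>_def T_def)
    also have "\<dots> = I * (1 - a / b)" by (simp add: I_def sum_distrib_right)
    finally have 2: "(\<Sum>u\<in>T. d u z * \<rho> u z) = I * (1 - a / b)" .
    have 3: "(\<Sum>w\<in>T. d z w * \<rho> z w) = 0" by (intro sum.neutral) (auto simp: \<rho>_def T_def)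
    have "cost S d \<pi> = J + I + K"
      using cost_split[OF S(1,2,2), of d \<pi>] by (simp add: d0 T_def I_def J_def K_def)
    moreover have "cost S d \<rho> = I * (1 - a / b) + (\<Sum>u\<in>T. \<Sum>w\<in>T. d u w * \<rho> u w)"
      using cost_split[OF S(1,2,2), of d \<rho>, folded T_def] 2 3 by (simp add: d0)
    ultimately show ?thesis using 1 by (simp add: algebra_simps)
  qed
  moreover have "stays S \<rho> z" by (simp add: stays_def \<rho>_def)
  moreover have "stays S \<rho> u" if "u \<in> S" "stays S \<pi> u" for u
    using that S by (auto simp: stays_def \<rho>_def)
  ultimately show ?thesis using that by blast
qed

text \<open>Treat the points of \<open>C\<close> one after another; those already treated keep
  staying.\<close>

lemma plan_stay_set:
  fixes \<pi> :: "'a \<Rightarrow> 'a \<Rightarrow> real"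
  assumes S: "finite S" and \<pi>: "plan S \<pi> f g"
    and C: "C \<subseteq> S" "\<And>z. z \<in> C \<Longrightarrow> f z \<le> g z"
    and tri: "\<And>u v w. u \<in> S \<Longrightarrow> v \<in> S \<Longrightarrow> w \<in> S \<Longrightarrow> d u w \<le> d u v + d v w"
    and d0: "\<And>u. u \<in> S \<Longrightarrow> d u u = 0"
  shows "\<exists>\<rho>. plan S \<rho> f g \<and> cost S d \<rho> \<le> cost S d \<pi> \<and> (\<forall>z\<in>C. stays S \<rho> z)"
proof -
  have "finite C" using C(1) S by (rule finite_subset)
  then show ?thesis using C
  proof (induction C)
    case empty
    then show ?case using \<pi> by auto
  next
    case (insert z C)
    then obtain \<rho> where \<rho>: "plan S \<rho> f g" "cost S d \<rho> \<le> cost S d \<pi>" "\<forall>z\<in>C. stays S \<rho> z"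
      by auto
    obtain \<rho>' where "plan S \<rho>' f g" "cost S d \<rho>' \<le> cost S d \<rho>" "stays S \<rho>' z"
        "\<And>u. u \<in> S \<Longrightarrow> stays S \<rho> u \<Longrightarrow> stays S \<rho>' u"
      by (rule plan_stay[OF S _ \<rho>(1), of z d]) (use insert.prems tri d0 in auto)
    then show ?case using \<rho> insert.prems by (intro exI[of _ \<rho>']) auto
  qed
qed

section \<open>Removing the supply at \<open>x\<close> and the demand at \<open>y\<close>\<close>

text \<open>Supply at \<open>x\<close> and demand at \<open>y\<close> are both \<open>p\<close>, so
  what \<open>x\<close> sends past \<open>y\<close> equals what \<open>y\<close> receives from
  elsewhere. Gluing these flows replaces the leg from \<open>z\<close> to \<open>y\<close> by one of
  length at most 1 from \<open>z\<close> to \<open>x\<close>. The last sum records how far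
  \<open>d z y\<close> falls short of 2.\<close>

lemma plan_glue:
  fixes \<pi> :: "'a \<Rightarrow> 'a \<Rightarrow> real"
  assumes S: "finite S" "x \<in> S" "y \<in> S" and \<pi>: "plan S \<pi> f g"
    and p: "f x = p" "g y = p" and dxy: "d x y = 1"
    and near: "\<And>z w. z \<in> S \<Longrightarrow> w \<in> S \<Longrightarrow> z \<noteq> x \<Longrightarrow> \<pi> z y \<noteq> 0 \<Longrightarrow> d z w \<le> 1 + d x w"
  obtains \<sigma> where "plan S \<sigma> (f(x := 0)) (g(y := 0))"
    "cost S d \<sigma> \<le> cost S d \<pi> - p + (\<Sum>z\<in>S - {x}. (2 - d z y) * \<pi> z y)"
proof -
  define X where "X = S - {x}"
  define Y where "Y = S - {y}"
  \<comment> \<open>The amount of mass to be glued, seen from either end: see \<open>qX\<close> and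
    \<open>qY\<close>.\<close>
  define q where "q = p - \<pi> x y"
  have nn: "0 \<le> \<pi> u v" if "u \<in> S" "v \<in> S" for u v using \<pi> that by (auto simp: plan_def)
  have X_eq: "sum h S = h x + sum h X" for h :: "'a \<Rightarrow> real"
    unfolding X_def using S(1,2) by (rule sum.remove)
  have Y_eq: "sum h S = h y + sum h Y" for h :: "'a \<Rightarrow> real"
    unfolding Y_def using S(1,3) by (rule sum.remove)
  have row: "\<pi> u y + (\<Sum>v\<in>Y. \<pi> u v) = f u" if "u \<in> S" for u
    using \<pi> that Y_eq[of "\<pi> u"] by (simp add: plan_def)
  have col: "\<pi> x v + (\<Sum>u\<in>X. \<pi> u v) = g v" if "v \<in> S" for v
    using \<pi> that X_eq[of "\<lambda>u. \<pi> u v"] by (simp add: plan_def)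
  have qX: "(\<Sum>z\<in>X. \<pi> z y) = q" and qY: "(\<Sum>w\<in>Y. \<pi> x w) = q"
    using row[OF S(2)] col[OF S(3)] p by (auto simp: q_def)
  have q: "0 \<le> q" unfolding qX[symmetric] using nn S by (auto simp: X_def intro!: sum_nonneg)
  have q0: "\<pi> z y = 0" if "q = 0" "z \<in> X" for z
    using qX[unfolded that(1)] that(2)
    by (rule sum_nonneg_0[rotated 2]) (use nn S in \<open>auto simp: X_def\<close>)
  have q0': "\<pi> x w = 0" if "q = 0" "w \<in> Y" for w
    using qY[unfolded that(1)] that(2)
    by (rule sum_nonneg_0[rotated 2]) (use nn S in \<open>auto simp: Y_def\<close>)
  define \<sigma> where "\<sigma> u v = (if u = x \<or> v = y then 0 else \<pi> u v + \<pi> u y * \<pi> x v / q)" for u v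
  have "plan S \<sigma> (f(x := 0)) (g(y := 0))"
    unfolding plan_def
  proof (intro conjI ballI)
    fix u v assume "u \<in> S" "v \<in> S"
    then show "0 \<le> \<sigma> u v" using nn S q by (auto simp: \<sigma>_def)
  next
    fix u assume u: "u \<in> S"
    show "(\<Sum>v\<in>S. \<sigma> u v) = (f(x := 0)) u"
    proof (cases "u = x")
      case False
      have "(\<Sum>v\<in>Y. \<sigma> u v) = (\<Sum>v\<in>Y. \<pi> u v + \<pi> u y * \<pi> x v / q)"
        using False by (intro sum.cong) (auto simp: \<sigma>_def Y_def)
      also have "\<dots> = (\<Sum>v\<in>Y. \<pi> u v) + \<pi> u y * q / q"
        by (simp add: sum.distrib qY[symmetric] sum_distrib_left sum_divide_distrib)
      also have "\<pi> u y * q / q = \<pi> u y" using q0[of u] u False by (auto simp: X_def)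
      finally show ?thesis using row[OF u] False by (simp add: Y_eq) (simp add: \<sigma>_def)
    qed (simp add: \<sigma>_def)
  next
    fix v assume v: "v \<in> S"
    show "(\<Sum>u\<in>S. \<sigma> u v) = (g(y := 0)) v"
    proof (cases "v = y")
      case False
      have "(\<Sum>u\<in>X. \<sigma> u v) = (\<Sum>u\<in>X. \<pi> u v + \<pi> u y * \<pi> x v / q)"
        using False by (intro sum.cong) (auto simp: \<sigma>_def X_def)
      also have "\<dots> = (\<Sum>u\<in>X. \<pi> u v) + q * \<pi> x v / q"
        by (simp add: sum.distrib qX[symmetric] sum_distrib_right sum_divide_distrib)
      also have "q * \<pi> x v / q = \<pi> x v" using q0'[of v] v False by (auto simp: Y_def)
      finally show ?thesis using col[OF v] False by (simp add: X_eq) (simp add: \<sigma>_def)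
    qed (simp add: \<sigma>_def)
  qed
  moreover have "cost S d \<sigma> \<le> cost S d \<pi> - p + (\<Sum>z\<in>S - {x}. (2 - d z y) * \<pi> z y)"
  proof -
    define J where "J = (\<Sum>w\<in>Y. d x w * \<pi> x w)"
    define K where "K = (\<Sum>z\<in>X. \<Sum>w\<in>Y. d z w * \<pi> z w)"
    define I where "I = (\<Sum>z\<in>X. d z y * \<pi> z y)"
    have "cost S d \<sigma> = (\<Sum>z\<in>X. \<Sum>w\<in>Y. d z w * \<sigma> z w)"
      unfolding cost_split[OF S, of d \<sigma>] X_def Y_def by (simp add: \<sigma>_def)
    also have "\<dots> = (\<Sum>z\<in>X. \<Sum>w\<in>Y. d z w * \<pi> z w + d z w * (\<pi> z y * \<pi> x w / q))"
      by (intro sum.cong refl) (auto simp: \<sigma>_def X_def Y_def algebra_simps)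
    also have "\<dots> = K + (\<Sum>z\<in>X. \<Sum>w\<in>Y. d z w * (\<pi> z y * \<pi> x w / q))"
      by (simp add: sum.distrib K_def)
    also have "(\<Sum>z\<in>X. \<Sum>w\<in>Y. d z w * (\<pi> z y * \<pi> x w / q)) \<le>
        (\<Sum>z\<in>X. 1 * \<pi> z y) * ((\<Sum>w\<in>Y. \<pi> x w) / q) + ((\<Sum>z\<in>X. \<pi> z y) / q) * J"
      unfolding J_def by (rule concat_cost_le) (use near nn S q in \<open>auto simp: X_def Y_def\<close>)
    also have "\<dots> = q + J" using q0' by (cases "q = 0") (auto simp: qX qY J_def)
    finally have "cost S d \<sigma> \<le> K + q + J" by simp
    moreover have "cost S d \<pi> = \<pi> x y + J + I + K"
      using cost_split[OF S, of d \<pi>] by (simp add: dxy X_def Y_def I_def J_def K_def)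
    moreover have "(\<Sum>z\<in>S - {x}. (2 - d z y) * \<pi> z y) = 2 * q - I"
      unfolding X_def[symmetric]
      by (simp add: left_diff_distrib sum_subtractf qX[symmetric] sum_distrib_left I_def)
    \<comment> \<open>With \<open>\<pi> x y = p - q\<close>, the bound \<open>K + q + J\<close>
      equals \<open>cost S d \<pi> - p + (2 * q - I)\<close>.\<close>
    ultimately show ?thesis by (simp add: q_def)
  qed
  ultimately show ?thesis using that by blast
qed

section \<open>Metric properties of the graph distance\<close>

lemma graph_dist_triangle: "graph_dist E u w \<le> graph_dist E u v + graph_dist E v w"
proof (cases "graph_dist E u v = \<infinity> \<or> graph_dist E v w = \<infinity>")
  case False
  \<comment> \<open>\<open>enat\<close> is well-ordered, so a finite distance is the length of an
    actual walk, and walks can be concatenated.\<close>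
  have attained: "\<exists>n. graph_dist E a b = enat n \<and> (adj E ^^ n) a b" if "graph_dist E a b \<noteq> \<infinity>" for a b
  proof -
    let ?A = "enat ` {n. (adj E ^^ n) a b}"
    have "?A \<noteq> {}"
      using that unfolding graph_dist_def by (metis Inf_empty top_enat_def)
    then have "Inf ?A \<in> ?A" unfolding Inf_enat_def by (metis LeastI_ex ex_in_conv)
    then obtain n where "Inf ?A = enat n" "(adj E ^^ n) a b" by blast
    then show ?thesis unfolding graph_dist_def by blast
  qed
  obtain m n where "graph_dist E u v = enat m" "(adj E ^^ m) u v"
    "graph_dist E v w = enat n" "(adj E ^^ n) v w" using False attained by meson
  moreover from this have "(adj E ^^ (m + n)) u w" by (auto simp: relpowp_add)
  then have "graph_dist E u w \<le> enat (m + n)" unfolding graph_dist_def by (auto intro: INF_lower)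
  ultimately show ?thesis by simp
qed auto

context
  fixes V :: "'a set" and E :: "'a set set" and x y :: 'a
  assumes graph: "locally_finite_graph V E" and xy: "adj E x y"
begin

text \<open>Distances within \<open>supp E x y\<close> are finite; this matters because
  \<open>rdist\<close> sends \<infinity> to 0.\<close>

lemma rdist_triangle:
  assumes "u \<in> supp E x y" "v \<in> supp E x y" "w \<in> supp E x y"
  shows "rdist E u w \<le> rdist E u v + rdist E v w"
proof -
  note ds = dist_supp[OF graph xy] and nn = rdist_nonneg[OF graph xy]
  have "ennreal_of_enat (graph_dist E u w) \<le> ennreal_of_enat (graph_dist E u v + graph_dist E v w)"
    using graph_dist_triangle by (simp only: ennreal_of_enat_le_iff)
  also have "\<dots> = ennreal_of_enat (graph_dist E u v) + ennreal_of_enat (graph_dist E v w)"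
    by (cases "graph_dist E u v"; cases "graph_dist E v w") auto
  finally have "ennreal (rdist E u w) \<le> ennreal (rdist E u v + rdist E v w)"
    using ds assms nn by simp
  then show ?thesis using nn by (subst (asm) ennreal_le_iff) auto
qed

lemma rdist_refl: "rdist E u u = 0"
proof -
  have "graph_dist E u u \<le> enat 0" by (rule graph_dist_le[OF graph]) simp
  then show ?thesis by (simp add: rdist_def[OF graph xy] zero_enat_def[symmetric])
qed

lemma rdist_adj_le: "adj E u v \<Longrightarrow> rdist E u v \<le> 1"
  using rdist_xy[OF graph, of u v] rdist_def[OF graph] by simp

text \<open>A walk of length 0 would give \<open>u = v\<close>, one of length 1 an edge.\<close>

lemma rdist_ge_2:
  assumes "u \<in> supp E x y" "v \<in> supp E x y" "u \<noteq> v" "\<not> adj E u v"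
  shows "2 \<le> rdist E u v"
proof -
  have "2 \<le> graph_dist E u v"
    unfolding graph_dist_def
  proof (rule INF_greatest)
    fix n assume n: "n \<in> {n. (adj E ^^ n) u v}"
    have "n \<noteq> 0" "n \<noteq> 1" using n assms(3,4) by (metis mem_Collect_eq relpowp.simps(1), auto)
    then show "2 \<le> enat n" by (simp add: numeral_eq_enat)
  qed
  then have "ennreal_of_enat 2 \<le> ennreal_of_enat (graph_dist E u v)"
    by (simp only: ennreal_of_enat_le_iff)
  moreover have "ennreal_of_enat 2 = ennreal 2"
    by (simp add: numeral_eq_enat)
  ultimately have "ennreal 2 \<le> ennreal (rdist E u v)"
    using dist_supp[OF graph xy assms(1,2)] by simp
  then show ?thesis using rdist_nonneg[OF graph xy] ennreal_le_iff by blast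
qed

lemma deg_pos: "0 < deg E x"
  unfolding deg_def using finite_nbrs[OF graph] adj_in[OF graph xy] xy by (auto simp: card_gt_0_iff)

end

section \<open>Comparing idleness \<open>p\<close> with idleness 0\<close>

lemma kappa_idle_le:
  assumes graph: "locally_finite_graph V E" and xy: "adj E x y" and deg: "deg E x \<ge> deg E y"
    and p: "0 \<le> p" "p < 1"
  shows "kappa_idle V E p x y / (1 - p) \<le> kappa_idle V E 0 x y + 2 / real (deg E x)"
proof -
  define S where "S = supp E x y"
  define d where "d = rdist E"
  define W where "W p = enn2real (W1 V E (idle_measure E p x) (idle_measure E p y))" for p
  note fin = supp_finite[OF graph xy, folded S_def]
  note xS = x_supp[OF graph xy, folded S_def] and yS = y_supp[OF graph xy, folded S_def]
  have yx: "adj E y x" using xy by (rule adj_sym)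
  have ne: "x \<noteq> y" using adj_in[OF graph xy] by simp
  have dpos: "0 < real (deg E x)" "0 < real (deg E y)"
    using deg_pos[OF graph xy] deg_pos[OF graph yx] by auto
  have tri: "d u w \<le> d u v + d v w" if "u \<in> S" "v \<in> S" "w \<in> S" for u v w
    using rdist_triangle[OF graph xy] that by (simp add: S_def d_def)
  \<comment> \<open>The claim multiplied out by \<open>1 - p\<close>; the slack \<open>e\<close>
    allows a nearly optimal coupling in place of the infimum.\<close>
  have "(1 - p) * W 0 \<le> W p - p + 2 * (1 - p) / real (deg E x) + e" if e: "0 < e" for e
  proof -
    obtain \<pi> where \<pi>: "\<pi> \<in> couplings V (idle_measure E p x) (idle_measure E p y)"
        "cost S d \<pi> < W p + e"
      using rW_approx[OF graph xy, of p e] p e unfolding cost_def S_def d_def W_def by auto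
    have "plan S \<pi> (idle_measure E p x) (idle_measure E p y)"
      using cpl_sums[OF graph xy \<pi>(1)] \<pi>(1) supp_V[OF graph xy]
      by (auto simp: plan_def S_def couplings_def subset_iff)
    moreover define C where "C = {z. adj E x z \<and> adj E y z}"
    have C: "C \<subseteq> S" by (auto simp: C_def S_def supp_def[OF graph xy])
    \<comment> \<open>The hypothesis on the degrees enters here: the larger degree gives the smaller
      share.\<close>
    have "idle_measure E p x z \<le> idle_measure E p y z" if "z \<in> C" for z
      using that adj_in[OF graph] p deg dpos
      by (auto simp: C_def idle_measure_def intro!: divide_left_mono)
    ultimately obtain \<rho> where \<rho>: "plan S \<rho> (idle_measure E p x) (idle_measure E p y)"
        "cost S d \<rho> \<le> cost S d \<pi>" "\<And>z. z \<in> C \<Longrightarrow> stays S \<rho> z"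
      using plan_stay_set[OF fin _ C, of \<pi> "idle_measure E p x" "idle_measure E p y" d]
        tri rdist_refl[OF graph xy] unfolding d_def by blast
    have nn: "0 \<le> \<rho> u v" if "u \<in> S" "v \<in> S" for u v using \<rho>(1) that by (auto simp: plan_def)
    have le: "\<rho> u v \<le> idle_measure E p x u" if "u \<in> S" "v \<in> S" for u v
    proof -
      have "\<rho> u v \<le> (\<Sum>v\<in>S. \<rho> u v)" using nn that fin by (intro member_le_sum) auto
      then show ?thesis using \<rho>(1) that by (simp add: plan_def)
    qed
    \<comment> \<open>A point that sends mass has positive supply, hence is \<open>x\<close> or a
      neighbour of \<open>x\<close>.\<close>
    have nbr: "adj E z x" if "z \<in> S" "v \<in> S" "z \<noteq> x" "\<rho> z v \<noteq> 0" for z v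
      using nn[OF that(1,2)] le[OF that(1,2)] that adj_sym[of E x z]
      by (auto simp: idle_measure_def split: if_splits)
    obtain \<sigma> where \<sigma>: "plan S \<sigma> ((idle_measure E p x)(x := 0)) ((idle_measure E p y)(y := 0))"
        "cost S d \<sigma> \<le> cost S d \<rho> - p + (\<Sum>z\<in>S - {x}. (2 - d z y) * \<rho> z y)"
    proof (rule plan_glue[OF fin xS yS \<rho>(1), of p d])
      show "d x y = 1" using rdist_xy[OF graph xy] by (simp add: d_def)
      fix z w assume z: "z \<in> S" "w \<in> S" "z \<noteq> x" "\<rho> z y \<noteq> 0"
      have "d z x \<le> 1" using rdist_adj_le[OF graph xy nbr[OF z(1) yS z(3,4)]] by (simp add: d_def)
      then show "d z w \<le> 1 + d x w" using tri[OF z(1) xS z(2)] by simp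
    qed (auto simp: idle_measure_def)
    \<comment> \<open>Only \<open>z = y\<close> can contribute positively. Any other
      \<open>z\<close> sending mass to \<open>y\<close> is a neighbour of \<open>x\<close> but not a
      common neighbour, since those stay; so \<open>d z y\<close> is at least 2.\<close>
    have "(\<Sum>z\<in>S - {x}. (2 - d z y) * \<rho> z y) \<le> (\<Sum>z\<in>S - {x}. if z = y then 2 * \<rho> y y else 0)"
    proof (rule sum_mono)
      fix z assume z: "z \<in> S - {x}"
      show "(2 - d z y) * \<rho> z y \<le> (if z = y then 2 * \<rho> y y else 0)"
      proof (cases "z = y")
        case True
        then show ?thesis using rdist_refl[OF graph xy] by (simp add: d_def)
      next
        case zy: False
        show ?thesis
        proof (cases "\<rho> z y = 0")
          case False
          then have "adj E x z" using nbr[of z y] z yS adj_sym by auto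
          then have "\<not> adj E z y"
            using \<rho>(3)[of z] False zy yS adj_sym[of E z y] by (auto simp: C_def stays_def)
          then have "2 \<le> d z y"
            using rdist_ge_2[OF graph xy, of z y] z yS zy by (simp add: S_def d_def)
          then show ?thesis using zy nn[of z y] z yS by (simp add: mult_nonpos_nonneg)
        qed (use zy in simp)
      qed
    qed
    also have "\<dots> = 2 * \<rho> y y" using fin yS ne by simp
    \<comment> \<open>As a neighbour of \<open>x\<close>, the point \<open>y\<close> has supply
      \<open>(1 - p) / deg E x\<close>, which bounds the mass staying there.\<close>
    also have "\<dots> \<le> 2 * (1 - p) / real (deg E x)"
      using mult_left_mono[OF le[OF yS yS], of 2] xy ne by (simp add: idle_measure_def)
    finally have c: "cost S d \<sigma> \<le> W p + e - p + 2 * (1 - p) / real (deg E x)"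
      using \<sigma>(2) \<rho>(2) \<pi>(2) by simp
    define \<tau> where "\<tau> u v = (if u \<in> S \<and> v \<in> S then \<sigma> u v / (1 - p) else 0)" for u v
    \<comment> \<open>Off its centre, the measure at idleness \<open>p\<close> is
      \<open>1 - p\<close> times the one at idleness 0, so rescaling \<open>\<sigma>\<close> gives a
      coupling.\<close>
    have idle0: "((idle_measure E p w)(w := 0)) u / (1 - p) = idle_measure E 0 w u" for w u
      using p by (simp add: idle_measure_def)
    have "\<tau> \<in> couplings V (idle_measure E 0 x) (idle_measure E 0 y)"
    proof (rule cplI[OF graph xy, folded S_def])
      fix u v assume "u \<in> S" "v \<in> S"
      then show "0 \<le> \<tau> u v" using \<sigma>(1) p by (auto simp: \<tau>_def plan_def)
    next
      fix u assume u: "u \<in> S"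
      then have "(\<Sum>v\<in>S. \<tau> u v) = (\<Sum>v\<in>S. \<sigma> u v) / (1 - p)"
        by (simp add: \<tau>_def sum_divide_distrib)
      then show "(\<Sum>v\<in>S. \<tau> u v) = idle_measure E 0 x u"
        using \<sigma>(1) u idle0[of x u] by (simp add: plan_def)
    next
      fix v assume v: "v \<in> S"
      then have "(\<Sum>u\<in>S. \<tau> u v) = (\<Sum>u\<in>S. \<sigma> u v) / (1 - p)"
        by (simp add: \<tau>_def sum_divide_distrib)
      then show "(\<Sum>u\<in>S. \<tau> u v) = idle_measure E 0 y v"
        using \<sigma>(1) v idle0[of y v] by (simp add: plan_def)
    qed (auto simp: \<tau>_def)
    then have "W 0 \<le> cost S d \<tau>"
      unfolding W_def cost_def S_def d_def by (rule rW_le[OF graph xy])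
    also have "\<dots> = cost S d \<sigma> / (1 - p)"
      by (simp add: cost_def \<tau>_def sum_divide_distrib)
    finally have "(1 - p) * W 0 \<le> cost S d \<sigma>" using p by (simp add: field_simps)
    then show ?thesis using c by linarith
  qed
  then have "(1 - p) * W 0 \<le> W p - p + 2 * (1 - p) / real (deg E x)" by (rule field_le_epsilon)
  then have "1 - W p \<le> (1 - p) * (1 - W 0 + 2 / real (deg E x))" by (simp add: algebra_simps)
  then show ?thesis
    using p by (simp add: kappa_idle_def W_def[symmetric] pos_divide_le_eq mult.commute)
qed

text \<open>The measure at idleness \<open>p\<close> mixes the one at idleness 0 with a point mass
  of weight \<open>p\<close>. Moving the point mass from \<open>x\<close> to \<open>y\<close> costs
  1 per unit, so \<open>W1\<close> at idleness \<open>p\<close> is at most \<open>1 - p\<close>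
  times its value at 0, plus \<open>p\<close>.\<close>

lemma kappa_idle_ge:
  assumes graph: "locally_finite_graph V E" and xy: "adj E x y" and p: "0 < p" "p < 1"
  shows "kappa_idle V E 0 x y \<le> kappa_idle V E p x y / (1 - p)"
  using rW_convex[OF graph xy, of 0 p] p by (simp add: kappa_idle_def field_simps)

theorem theorem5p5:
  fixes V :: "'a set" and E :: "'a set set" and x y :: 'a
  assumes "locally_finite_graph V E"
    and "x \<in> V" and "y \<in> V" and "adj E x y"
    and "deg E x \<ge> deg E y"
  shows "kappa_idle V E 0 x y \<le> kappa V E x y \<and>
         kappa V E x y \<le> kappa_idle V E 0 x y + 2 / real (deg E x)"
proof -
  note lim = kappa_tendsto[OF assms(1,4)]
  \<comment> \<open>Both bounds hold for every \<open>p\<close> strictly between 0 and 1, hence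
    eventually from the left at 1, and pass to the limit.\<close>
  have ev: "\<forall>\<^sub>F p in at_left 1. p \<in> {0<..<1::real}" by (rule eventually_at_leftI[of 0]) auto
  show ?thesis
  proof
    show "kappa_idle V E 0 x y \<le> kappa V E x y"
      by (rule tendsto_lowerbound[OF lim], rule eventually_mono[OF ev])
        (use kappa_idle_ge[OF assms(1,4)] in auto)
    show "kappa V E x y \<le> kappa_idle V E 0 x y + 2 / real (deg E x)"
      by (rule tendsto_upperbound[OF lim], rule eventually_mono[OF ev])
        (use kappa_idle_le[OF assms(1,4,5)] in auto)
  qed
qed

end
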